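(* Let $T\ge 1$. Suppose that for each round $t=0,\dots,T-1$ the round-$t$ release mechanism $\mathcal M_t(\mathcal D)=(g_{1,t},\dots,g_{n,t})$ satisfies $(\varepsilon_t,\delta_t)$-differential privacy with respect to federated record-level replace-one adjacency (for every fixed value of the previous server state). Then the full $T$-round DP-FedSOFIM algorithm satisfies \[ \Bigl(\sum_{t=0}^{T-1}\varepsilon_t,\ \sum_{t=0}^{T-1}\delta_t\Bigr)\text{-differential privacy}. \] In particular, if the same per-round privacy parameters $(\varepsilon_0,\delta_0)$ are used at every round, then the overall procedure satisfies $(T\varepsilon_0,T\delta_0)$-differential privacy.
   Context: Federated data: $\mathcal D=(\mathcal D_1,\dots,\mathcal D_n)$, where client $i$ holds a finite dataset $\mathcal D_i$ of records $(x,y)$. Two federated datasets are neighboring (record-level replace-one adjacency) if they differ in exactly one record of exactly one client's dataset, that client's dataset keeping the same size: $\mathcal D_i'=(\mathcal D_i\setminus\{z\})\cup\{z'\}$. A randomized mechanism $\mathcal M$ is $(\varepsilon,\delta)$-differentially private if for all neighboring $\mathcal D,\mathcal D'$ and all measurable sets $S$, $\mathbb P[\mathcal M(\mathcal D)\in S]\le e^{\varepsilon}\,\mathbb P[\mathcal M(\mathcal D')\in S]+\delta$. DP-FedSOFIM: fixed data-independent $\theta_0\in\mathbb R^d$, $M_{-1}=0\in\mathbb R^d$, $\beta\in[0,1)$, $\rho>0$, stepsizes $\eta_t>0$, clipping threshold $C_g>0$, noise multiplier $\sigma_g>0$, differentiable loss $\ell(\theta;x,y)$. At round $t$, given the server state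 $(\theta_t,M_{t-1})$, each client $i$ releases $g_{i,t}=\frac1{|\mathcal D_i|}\bigl(\sum_{(x,y)\in\mathcal D_i}\bar g_t(x,y)+E_{i,t}\bigr)$, where $\bar g_t(x,y)=\nabla\ell(\theta_t;x,y)\min\bigl(1,C_g/\|\nabla\ell(\theta_t;x,y)\|_2\bigr)$ and $E_{i,t}\sim\mathcal N\bigl(0,\frac{(C_g\sigma_g)^2}{n}I_d\bigr)$ are independent over $i$ and $t$. The server computes $G_t=\frac1n\sum_i g_{i,t}$, $M_t=\beta M_{t-1}+(1-\beta)G_t$, $H_t=(\rho I_d+M_tM_t^\top)^{-1}$, $\theta_{t+1}=\theta_t-\eta_tH_tG_t$. The output of the full algorithm is the sequence of server outputs $(M_t,H_t,\theta_{t+1})_{t=0}^{T-1}$. The per-round privacy hypothesis is understood conditionally on the previous server state, i.e. for the mechanism $\mathcal D\mapsto(g_{1,t},\dots,g_{n,t})$ with $(\theta_t,M_{t-1})$ held fixed at an arbitrary value. *)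

theory Defs
  imports "HOL-Probability.Probability"
begin

section \<open>Differential privacy\<close>

text \<open>
  A randomized mechanism assigns to each input a probability law on the output space \<open>\<Omega>\<close>.
  Requiring this explicitly excludes degenerate laws, such as a \<^const>\<open>distr\<close> along a
  non-measurable map, for which the inequality below could hold vacuously.
\<close>

definition randomized_mechanism :: "'b measure \<Rightarrow> ('a \<Rightarrow> 'b measure) \<Rightarrow> bool" where
  "randomized_mechanism \<Omega> \<M> \<longleftrightarrow> (\<forall>D. prob_space (\<M> D) \<and> sets (\<M> D) = sets \<Omega>)"

definition differentially_private ::
    "('a \<Rightarrow> 'a \<Rightarrow> bool) \<Rightarrow> 'b measure \<Rightarrow> ('a \<Rightarrow> 'b measure) \<Rightarrow> real \<Rightarrow> real \<Rightarrow> bool" where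
  "differentially_private adj \<Omega> \<M> \<epsilon> \<delta> \<longleftrightarrow>
     randomized_mechanism \<Omega> \<M> \<and>
     (\<forall>D D'. adj D D' \<longrightarrow>
        (\<forall>S\<in>sets \<Omega>. measure (\<M> D) S \<le> exp \<epsilon> * measure (\<M> D') S + \<delta>))"

section \<open>Federated data\<close>

text \<open>
  The clients are the elements of the finite type \<open>'c\<close>, so \<open>n = CARD('c)\<close>. Datasets are finite
  multisets of records, so that removing one record and inserting another preserves the size.
\<close>

type_synonym ('c, 'x, 'y) federated = "'c \<Rightarrow> ('x \<times> 'y) multiset"

text \<open>
  The algorithm divides by the size of every local dataset, so all of them have to be nonempty.
\<close>

definition neighboring :: "('c, 'x, 'y) federated \<Rightarrow> ('c, 'x, 'y) federated \<Rightarrow> bool" where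
  "neighboring D D' \<longleftrightarrow>
     (\<forall>i. D i \<noteq> {#}) \<and>
     (\<exists>i z z'. z \<in># D i \<and> z' \<noteq> z \<and> D' = D(i := D i - {#z#} + {#z'#}))"

section \<open>DP-FedSOFIM\<close>

definition gradient :: "('v::real_inner \<Rightarrow> real) \<Rightarrow> 'v \<Rightarrow> 'v" where
  "gradient f x = (THE g. GDERIV f x :> g)"

text \<open>
  For a zero gradient, \<open>C / 0 = 0\<close> makes the clipping factor zero, but the clipped gradient
  is then zero in any case.
\<close>

definition clip :: "real \<Rightarrow> 'v::real_normed_vector \<Rightarrow> 'v" where
  "clip C g = min 1 (C / norm g) *\<^sub>R g"

text \<open>The isotropic Gaussian law with mean \<open>0\<close> and covariance \<open>s\<^sup>2 I\<^sub>d\<close> (\<open>s\<close> is the standard deviation).\<close>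

definition isotropic_gaussian :: "real \<Rightarrow> (real^'d) measure" where
  "isotropic_gaussian s =
     distr (\<Pi>\<^sub>M j\<in>(UNIV :: 'd::finite set). density lborel (normal_density 0 s)) borel (\<lambda>f. \<chi> j. f j)"

text \<open>
  Joint law of the noise vectors of all clients in one round: independent, each with covariance
  \<open>((C\<^sub>g \<sigma>\<^sub>g)\<^sup>2 / n) I\<^sub>d\<close>.
\<close>

definition round_noise :: "real \<Rightarrow> real \<Rightarrow> ('c::finite \<Rightarrow> real^'d::finite) measure" where
  "round_noise Cg \<sigma>g =
     (\<Pi>\<^sub>M i\<in>UNIV. isotropic_gaussian (Cg * \<sigma>g / sqrt (real CARD('c))))"

text \<open>A server state before round \<open>t\<close> is the pair \<open>(\<theta>\<^sub>t, M\<^bsub>t-1\<^esub>)\<close>.\<close>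

type_synonym 'd server_state = "(real^'d) \<times> (real^'d)"

text \<open>Client \<open>i\<close>'s release \<open>g\<^bsub>i,t\<^esub>\<close>, as a function of the server state and the round's noise \<open>E\<close>.\<close>

definition client_release ::
    "(real^'d \<Rightarrow> 'x \<Rightarrow> 'y \<Rightarrow> real) \<Rightarrow> real \<Rightarrow> ('c, 'x, 'y) federated \<Rightarrow>
     'd::finite server_state \<Rightarrow> ('c \<Rightarrow> real^'d) \<Rightarrow> 'c \<Rightarrow> real^'d" where
  "client_release loss Cg D st E i =
     (1 / real (size (D i))) *\<^sub>R
       ((\<Sum>(x, y)\<in>#D i. clip Cg (gradient (\<lambda>\<theta>. loss \<theta> x y) (fst st))) + E i)"

text \<open>
  The mechanism \<open>D \<mapsto> (g\<^bsub>1,t\<^esub>, \<dots>, g\<^bsub>n,t\<^esub>)\<close> with the previous server state held fixed. The noise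
  being identically distributed over the rounds, \<open>t\<close> enters only through the server state.
\<close>

definition release_space :: "('c \<Rightarrow> real^'d::finite) measure" where
  "release_space = (\<Pi>\<^sub>M i\<in>UNIV. borel)"

definition release_mechanism ::
    "(real^'d \<Rightarrow> 'x \<Rightarrow> 'y \<Rightarrow> real) \<Rightarrow> real \<Rightarrow> real \<Rightarrow> 'd::finite server_state \<Rightarrow>
     ('c::finite, 'x, 'y) federated \<Rightarrow> ('c \<Rightarrow> real^'d) measure" where
  "release_mechanism loss Cg \<sigma>g st D =
     distr (round_noise Cg \<sigma>g) release_space (client_release loss Cg D st)"

definition aggregate :: "('c::finite \<Rightarrow> real^'d) \<Rightarrow> real^'d::finite" where
  "aggregate g = (1 / real CARD('c)) *\<^sub>R (\<Sum>i\<in>UNIV. g i)"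

definition preconditioner :: "real \<Rightarrow> real^'d \<Rightarrow> real^'d^'d::finite" where
  "preconditioner \<rho> M = matrix_inv (mat \<rho> + (\<chi> i j. M $ i * M $ j))"

text \<open>
  One server step with step size \<open>h\<close>, from the state \<open>(\<theta>\<^sub>t, M\<^bsub>t-1\<^esub>)\<close> to the state
  \<open>(\<theta>\<^bsub>t+1\<^esub>, M\<^sub>t)\<close>.
\<close>

definition server_update ::
    "real \<Rightarrow> real \<Rightarrow> real \<Rightarrow> 'd::finite server_state \<Rightarrow> ('c::finite \<Rightarrow> real^'d) \<Rightarrow> 'd server_state" where
  "server_update \<beta> \<rho> h st g =
     (let G = aggregate g; M = \<beta> *\<^sub>R snd st + (1 - \<beta>) *\<^sub>R G
      in (fst st - h *\<^sub>R (preconditioner \<rho> M *v G), M))"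

text \<open>The server state before round \<open>t\<close> when \<open>E s i\<close> is the noise of client \<open>i\<close> in round \<open>s\<close>.\<close>

primrec fedsofim_state ::
    "(real^'d \<Rightarrow> 'x \<Rightarrow> 'y \<Rightarrow> real) \<Rightarrow> real^'d \<Rightarrow> real \<Rightarrow> real \<Rightarrow> (nat \<Rightarrow> real) \<Rightarrow> real \<Rightarrow>
     ('c::finite, 'x, 'y) federated \<Rightarrow> (nat \<Rightarrow> 'c \<Rightarrow> real^'d) \<Rightarrow> nat \<Rightarrow> 'd::finite server_state" where
  "fedsofim_state loss \<theta>0 \<beta> \<rho> \<eta> Cg D E 0 = (\<theta>0, 0)"
| "fedsofim_state loss \<theta>0 \<beta> \<rho> \<eta> Cg D E (Suc t) =
     (let st = fedsofim_state loss \<theta>0 \<beta> \<rho> \<eta> Cg D E t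
      in server_update \<beta> \<rho> (\<eta> t) st (client_release loss Cg D st (E t)))"

text \<open>The output sequence \<open>(M\<^sub>t, H\<^sub>t, \<theta>\<^bsub>t+1\<^esub>)\<close> for \<open>t < T\<close>.\<close>

definition fedsofim_output ::
    "(real^'d \<Rightarrow> 'x \<Rightarrow> 'y \<Rightarrow> real) \<Rightarrow> real^'d \<Rightarrow> real \<Rightarrow> real \<Rightarrow> (nat \<Rightarrow> real) \<Rightarrow> real \<Rightarrow> nat \<Rightarrow>
     ('c::finite, 'x, 'y) federated \<Rightarrow> (nat \<Rightarrow> 'c \<Rightarrow> real^'d) \<Rightarrow>
     nat \<Rightarrow> (real^'d) \<times> (real^'d^'d) \<times> (real^'d::finite)" where
  "fedsofim_output loss \<theta>0 \<beta> \<rho> \<eta> Cg T D E =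
     (\<lambda>t\<in>{..<T}. let (\<theta>, M) = fedsofim_state loss \<theta>0 \<beta> \<rho> \<eta> Cg D E (Suc t)
                 in (M, preconditioner \<rho> M, \<theta>))"

definition output_space :: "nat \<Rightarrow> (nat \<Rightarrow> (real^'d) \<times> (real^'d^'d) \<times> (real^'d::finite)) measure" where
  "output_space T = (\<Pi>\<^sub>M t\<in>{..<T}. borel)"

text \<open>The full \<open>T\<close>-round algorithm, with noise independent over clients and rounds.\<close>

definition dp_fedsofim ::
    "(real^'d \<Rightarrow> 'x \<Rightarrow> 'y \<Rightarrow> real) \<Rightarrow> real^'d \<Rightarrow> real \<Rightarrow> real \<Rightarrow> (nat \<Rightarrow> real) \<Rightarrow> real \<Rightarrow> real \<Rightarrow> nat \<Rightarrow>
     ('c::finite, 'x, 'y) federated \<Rightarrow>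
     (nat \<Rightarrow> (real^'d) \<times> (real^'d^'d) \<times> (real^'d::finite)) measure" where
  "dp_fedsofim loss \<theta>0 \<beta> \<rho> \<eta> Cg \<sigma>g T D =
     distr (\<Pi>\<^sub>M t\<in>{..<T}. round_noise Cg \<sigma>g) (output_space T)
       (fedsofim_output loss \<theta>0 \<beta> \<rho> \<eta> Cg T D)"

end

theory Submission
  imports Defs
begin

text \<open>
  Given the outputs \<open>w\<close> of the earlier rounds, the law of the next output is a post-processing of the
  release mechanism at the server state determined by \<open>w\<close>; the algorithm is therefore an iterated
  Giry bind. In one bind, the probability \<open>k w\<close> that the new round hits \<open>S\<close> is at most
  \<open>min 1 (exp \<epsilon>' * l w) + \<delta>'\<close>, where \<open>l w\<close> is the same probability for the neighboring dataset. The
  truncation at \<open>1\<close> makes the first summand a test function with values in \<open>[0, 1]\<close>, so passing to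
  the neighboring dataset in the earlier rounds costs only a further \<open>\<delta>\<close>, not multiplied by \<open>exp \<epsilon>'\<close>.
\<close>

section \<open>Adaptive composition\<close>

text \<open>The privacy inequality for one ordered pair of laws, so that composition can be carried
  out for two fixed datasets, apart from the adjacency relation.\<close>

definition indistinguishable :: "real \<Rightarrow> real \<Rightarrow> 'a measure \<Rightarrow> 'a measure \<Rightarrow> bool" where
  "indistinguishable \<epsilon> \<delta> M N \<longleftrightarrow> (\<forall>S\<in>sets M. measure M S \<le> exp \<epsilon> * measure N S + \<delta>)"

lemma indistinguishableD:
  "indistinguishable \<epsilon> \<delta> M N \<Longrightarrow> S \<in> sets M \<Longrightarrow> measure M S \<le> exp \<epsilon> * measure N S + \<delta>"
  by (simp add: indistinguishable_def)

text \<open>The empty set forces the sign of \<open>\<delta>\<close>, on which the truncation at 1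
  in \<open>indistinguishable_bind\<close> relies.\<close>

lemma indistinguishable_nonneg:
  assumes "indistinguishable \<epsilon> \<delta> M N"
  shows "\<delta> \<ge> 0"
  using indistinguishableD[OF assms, of "{}"] by simp

lemma indistinguishable_refl: "indistinguishable 0 0 M M"
  by (simp add: indistinguishable_def)

text \<open>Post-processing: the preimage of a measurable set is again a set to which the bound
  applies.\<close>

lemma indistinguishable_distr:
  assumes "indistinguishable \<epsilon> \<delta> M N" "sets N = sets M" "f \<in> M \<rightarrow>\<^sub>M B"
  shows "indistinguishable \<epsilon> \<delta> (distr M B f) (distr N B f)"
proof -
  have "f \<in> N \<rightarrow>\<^sub>M B" "space N = space M"
    using assms measurable_cong_sets sets_eq_imp_space_eq by blast+
  with assms show ?thesis
    by (auto simp: indistinguishable_def measure_distr)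
qed

text \<open>Brings pushforwards into integral form, so that the noise of a single round can later be
  split off by Fubini.\<close>

lemma emeasure_distr_integral:
  assumes f: "f \<in> M \<rightarrow>\<^sub>M N" and A: "A \<in> sets N"
  shows "emeasure (distr M N f) A = (\<integral>\<^sup>+x. indicator A (f x) \<partial>M)"
proof -
  have "emeasure (distr M N f) A = (\<integral>\<^sup>+y. indicator A y \<partial>distr M N f)"
    using A by simp
  also have "\<dots> = (\<integral>\<^sup>+x. indicator A (f x) \<partial>M)"
    using A by (intro nn_integral_distr[OF f]) simp
  finally show ?thesis .
qed

text \<open>The sum counts the \<open>k \<ge> 1\<close> below \<open>n * y\<close>, so it is the
  floor of \<open>n * y\<close>, and \<open>s\<close> is \<open>y\<close> rounded down to a multiple
  of \<open>1 / n\<close>.\<close>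

lemma floor_step_function:
  fixes y :: real
  assumes "0 \<le> y" "y \<le> 1" "n > 0"
  defines "s \<equiv> (\<Sum>k=1..n. of_bool (real k \<le> real n * y)) / real n"
  shows "s \<le> y" "y \<le> s + 1 / real n"
proof -
  define m where "m = nat \<lfloor>real n * y\<rfloor>"
  have m: "real m \<le> real n * y" "real n * y < real m + 1"
    using assms by (auto simp: m_def)
  have "real n * y \<le> real n"
    using assms by (simp add: mult_left_le)
  then have "m \<le> n" using m(1) by linarith
  then have "{1..n} \<inter> {k. real k \<le> real n * y} = {1..m}"
    using m by auto
  then have "(\<Sum>k=1..n. of_bool (real k \<le> real n * y) :: real) = real m"
    by (subst of_bool_def) (simp add: sum.If_cases)
  then have s: "s = real m / real n"
    by (simp only: s_def)
  show "s \<le> y" "y \<le> s + 1 / real n"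
    unfolding s using m \<open>n > 0\<close> by (simp_all add: field_simps)
qed

text \<open>
  A function into \<open>[0, 1]\<close> is the average of the indicators of its superlevel sets, so the
  additive term \<open>\<delta>\<close> is averaged rather than summed.
\<close>

lemma indistinguishable_integral:
  assumes "prob_space M" "prob_space N" and sets: "sets N = sets M"
    and ind: "indistinguishable \<epsilon> \<delta> M N"
    and f[measurable]: "f \<in> borel_measurable M"
    and bounds: "\<And>x. x \<in> space M \<Longrightarrow> 0 \<le> f x \<and> f x \<le> 1"
  shows "(\<integral>x. f x \<partial>M) \<le> exp \<epsilon> * (\<integral>x. f x \<partial>N) + \<delta>"
proof -
  interpret M: prob_space M by fact
  interpret N: prob_space N by fact
  have space: "space N = space M" by (rule sets_eq_imp_space_eq[OF sets])
  have fN[measurable]: "f \<in> borel_measurable N"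
    using f sets measurable_cong_sets by blast
  have intM: "integrable M f" and intN: "integrable N f"
    using bounds space by (auto intro!: M.integrable_const_bound[where B=1] N.integrable_const_bound[where B=1])
  \<comment> \<open>Rounding \<open>f\<close> down to multiples of \<open>1 / Suc n\<close> costs at
    most one such step under \<open>M\<close>; letting \<open>n\<close> grow removes this
    error.\<close>
  have "(\<integral>x. f x \<partial>M) - (exp \<epsilon> * (\<integral>x. f x \<partial>N) + \<delta>) \<le> 1 / real (Suc n)" for n
  proof -
    define A where "A k = {x \<in> space M. real k \<le> real (Suc n) * f x}" for k :: nat
    define s where "s x = (\<Sum>k=1..Suc n. indicator (A k) x) / real (Suc n)" for x
    have A[measurable]: "A k \<in> sets M" for k by (simp add: A_def)
    have AN[measurable]: "A k \<in> sets N" for k using A sets by simp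
    have s: "s x = (\<Sum>k=1..Suc n. of_bool (real k \<le> real (Suc n) * f x)) / real (Suc n)"
      if "x \<in> space M" for x
      unfolding s_def using that by (intro arg_cong2[where f="(/)"] sum.cong) (auto simp: A_def indicator_def)
    have s_le: "s x \<le> f x" and le_s: "f x \<le> s x + 1 / real (Suc n)" if "x \<in> space M" for x
      using floor_step_function[of "f x" "Suc n"] bounds[OF that] unfolding s[OF that] by auto
    have int_s: "(\<integral>x. s x \<partial>M) = (\<Sum>k=1..Suc n. measure M (A k)) / real (Suc n)"
      "(\<integral>x. s x \<partial>N) = (\<Sum>k=1..Suc n. measure N (A k)) / real (Suc n)"
      unfolding s_def
      by (subst integral_divide_zero, subst Bochner_Integration.integral_sum;
          simp add: M.emeasure_eq_measure N.emeasure_eq_measure)+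
    have ints: "integrable M s" "integrable N s"
      unfolding s_def
      by (auto intro!: integrable_divide_zero Bochner_Integration.integrable_sum
          simp: M.emeasure_eq_measure N.emeasure_eq_measure simp del: sum.cl_ivl_Suc)
    have "(\<integral>x. f x \<partial>M) \<le> (\<integral>x. s x + 1 / real (Suc n) \<partial>M)"
      using intM ints le_s by (intro integral_mono) auto
    also have "\<dots> = (\<integral>x. s x \<partial>M) + 1 / real (Suc n)"
      using ints by (simp add: M.prob_space)
    \<comment> \<open>Each of the \<open>Suc n\<close> level sets contributes one
      \<open>\<delta>\<close>; the division by \<open>Suc n\<close> reduces them to a single
      one.\<close>
    also have "(\<integral>x. s x \<partial>M) \<le> (\<Sum>k=1..Suc n. exp \<epsilon> * measure N (A k) + \<delta>) / real (Suc n)"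
      unfolding int_s by (intro divide_right_mono sum_mono indistinguishableD[OF ind] A) auto
    also have "\<dots> = exp \<epsilon> * (\<integral>x. s x \<partial>N) + \<delta>"
      unfolding int_s by (simp add: sum.distrib sum_distrib_left[symmetric] add_divide_distrib del: sum.cl_ivl_Suc)
    also have "(\<integral>x. s x \<partial>N) \<le> (\<integral>x. f x \<partial>N)"
      using intN ints s_le space by (intro integral_mono) auto
    finally show ?thesis by simp
  qed
  then have "(\<integral>x. f x \<partial>M) - (exp \<epsilon> * (\<integral>x. f x \<partial>N) + \<delta>) \<le> 0"
    by (intro LIMSEQ_le_const[OF LIMSEQ_Suc[OF lim_1_over_n]]) auto
  then show ?thesis by simp
qed

text \<open>Adaptive basic composition: the second-stage laws may depend on the first output
  \<open>x\<close>, with a bound uniform in \<open>x\<close>.\<close>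

lemma indistinguishable_bind:
  assumes "prob_space M" "prob_space N" and sets: "sets N = sets M"
    and K: "K \<in> M \<rightarrow>\<^sub>M prob_algebra B" and L: "L \<in> M \<rightarrow>\<^sub>M prob_algebra B"
    and MN: "indistinguishable \<epsilon> \<delta> M N"
    and KL: "\<And>x. x \<in> space M \<Longrightarrow> indistinguishable \<epsilon>' \<delta>' (K x) (L x)"
  shows "indistinguishable (\<epsilon> + \<epsilon>') (\<delta> + \<delta>') (M \<bind> K) (N \<bind> L)"
  unfolding indistinguishable_def
proof
  interpret M: prob_space M by fact
  interpret N: prob_space N by fact
  have space: "space N = space M" by (rule sets_eq_imp_space_eq[OF sets])
  have LN: "L \<in> N \<rightarrow>\<^sub>M prob_algebra B"
    using L sets measurable_cong_sets by blast
  have K_space: "prob_space (K x)" "sets (K x) = sets B" if "x \<in> space M" for x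
    using measurable_space[OF K that] by (auto simp: space_prob_algebra)
  have L_space: "prob_space (L x)" if "x \<in> space M" for x
    using measurable_space[OF L that] by (auto simp: space_prob_algebra)
  fix S assume "S \<in> sets (M \<bind> K)"
  then have S[measurable]: "S \<in> sets B"
    using K_space M.not_empty by (subst (asm) sets_bind[where N = B]) auto
  define k where "k x = measure (K x) S" for x
  define l where "l x = measure (L x) S" for x
  have [measurable]: "k \<in> borel_measurable M" "l \<in> borel_measurable M" "l \<in> borel_measurable N"
    unfolding k_def l_def
    using measurable_compose[OF K measurable_measure_prob_algebra[OF S]]
      measurable_compose[OF L measurable_measure_prob_algebra[OF S]]
      measurable_compose[OF LN measurable_measure_prob_algebra[OF S]] by simp_all
  define h where "h x = min 1 (exp \<epsilon>' * l x)" for x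
  have hM[measurable]: "h \<in> borel_measurable M" "h \<in> borel_measurable N"
    unfolding h_def by measurable
  have l: "0 \<le> l x" "l x \<le> 1" if "x \<in> space M" for x
    using L_space[OF that] by (auto simp: l_def prob_space.prob_le_1)
  have k: "0 \<le> k x" "k x \<le> 1" if "x \<in> space M" for x
    using K_space(1)[OF that] by (auto simp: k_def prob_space.prob_le_1)
  have h: "0 \<le> h x" "h x \<le> 1" if "x \<in> space M" for x
    using l[OF that] by (auto simp: h_def)
  \<comment> \<open>Where the minimum is 1, \<open>k x \<le> 1\<close> and
    \<open>\<delta>' \<ge> 0\<close> suffice; elsewhere this is the bound on the kernels.\<close>
  have k_le: "k x \<le> h x + \<delta>'" if "x \<in> space M" for x
    using indistinguishableD[OF KL[OF that], of S] K_space[OF that] k[OF that]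
      indistinguishable_nonneg[OF KL[OF that]]
    by (auto simp: h_def k_def l_def min_def)
  have int: "integrable M k" "integrable M h" "integrable N h" "integrable N l"
    using k h l space
    by (auto intro!: M.integrable_const_bound[where B=1] N.integrable_const_bound[where B=1])
  have "measure (M \<bind> K) S = (\<integral>x. k x \<partial>M)"
    unfolding k_def by (rule M.measure_bind[OF measurable_prob_algebraD[OF K] S])
  also have "\<dots> \<le> (\<integral>x. h x + \<delta>' \<partial>M)"
    using int k_le by (intro integral_mono) auto
  also have "\<dots> = (\<integral>x. h x \<partial>M) + \<delta>'"
    using int by (simp add: M.prob_space)
  also have "(\<integral>x. h x \<partial>M) \<le> exp \<epsilon> * (\<integral>x. h x \<partial>N) + \<delta>"
    using h by (intro indistinguishable_integral) (use assms in auto)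
  \<comment> \<open>The truncation is dropped only after the change from \<open>M\<close> to
    \<open>N\<close>, when no further additive term arises.\<close>
  also have "(\<integral>x. h x \<partial>N) \<le> (\<integral>x. exp \<epsilon>' * l x \<partial>N)"
    using int by (intro integral_mono) (auto simp: h_def)
  also have "\<dots> = exp \<epsilon>' * (\<integral>x. l x \<partial>N)"
    by simp
  also have "(\<integral>x. l x \<partial>N) = measure (N \<bind> L) S"
    unfolding l_def by (rule N.measure_bind[OF measurable_prob_algebraD[OF LN] S, symmetric])
  finally show "measure (M \<bind> K) S \<le> exp (\<epsilon> + \<epsilon>') * measure (N \<bind> L) S + (\<delta> + \<delta>')"
    by (simp add: exp_add mult.assoc)
qed

section \<open>Measurability of one round\<close>

text \<open>Justifies the \<open>THE\<close> in \<open>gradient\<close>: the values of the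
  derivative on the orthonormal basis are the coordinates of a representing vector, and the inner
  product determines that vector uniquely.\<close>

lemma GDERIV_gradient:
  fixes f :: "'v::euclidean_space \<Rightarrow> real"
  assumes "f differentiable (at x)"
  shows "GDERIV f x :> gradient f x"
proof -
  obtain F where F: "(f has_derivative F) (at x)"
    using assms by (auto simp: differentiable_def)
  define g where "g = (\<Sum>b\<in>Basis. F b *\<^sub>R b)"
  have "F h = h \<bullet> g" for h
  proof -
    have "F h = F (\<Sum>b\<in>Basis. (h \<bullet> b) *\<^sub>R b)"
      by (simp add: euclidean_representation)
    also have "\<dots> = (\<Sum>b\<in>Basis. (h \<bullet> b) * F b)"
      using has_derivative_linear[OF F] by (simp add: linear_sum linear_cmul)
    finally show ?thesis
      by (simp add: g_def inner_sum_right mult.commute)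
  qed
  then have "F = (\<lambda>h. h \<bullet> g)" by auto
  with F have g: "GDERIV f x :> g" by (simp add: gderiv_def)
  have "g' = g" if "GDERIV f x :> g'" for g'
  proof -
    have "(\<lambda>h. h \<bullet> g') = (\<lambda>h. h \<bullet> g)"
      using that g unfolding gderiv_def by (rule has_derivative_unique)
    \<comment> \<open>In the direction \<open>g' - g\<close> the two functionals differ by the
      squared norm of \<open>g' - g\<close>.\<close>
    then have "(g' - g) \<bullet> g' = (g' - g) \<bullet> g"
      by (rule fun_cong)
    then have "(g' - g) \<bullet> (g' - g) = 0"
      by (simp add: inner_diff_right)
    then show ?thesis
      by simp
  qed
  with g show ?thesis
    unfolding gradient_def by (rule theI)
qed

text \<open>A limit along a sequence, rather than along all real step sizes, is the form in which
  measurability passes to the limit.\<close>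

lemma gradient_difference_quotient:
  fixes f :: "'v::euclidean_space \<Rightarrow> real"
  assumes "f differentiable (at x)"
  shows "(\<lambda>n. (f (x + (1 / real (Suc n)) *\<^sub>R b) - f x) / (1 / real (Suc n))) \<longlonglongrightarrow> gradient f x \<bullet> b"
proof -
  have "(f has_derivative (\<lambda>h. h \<bullet> gradient f x)) (at x)"
    using GDERIV_gradient[OF assms] by (simp add: gderiv_def)
  moreover have "((\<lambda>t. x + t *\<^sub>R b) has_derivative (\<lambda>t. t *\<^sub>R b)) (at 0)"
    by (auto intro!: derivative_eq_intros)
  ultimately have "((\<lambda>t. f (x + t *\<^sub>R b)) has_derivative (\<lambda>t. (t *\<^sub>R b) \<bullet> gradient f x)) (at 0)"
    by (intro has_derivative_compose[of "\<lambda>t. x + t *\<^sub>R b" _ 0 UNIV f]) auto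
  then have "((\<lambda>t. f (x + t *\<^sub>R b)) has_real_derivative b \<bullet> gradient f x) (at 0)"
    by (simp add: has_field_derivative_def mult_commute_abs)
  then have "((\<lambda>t. (f (x + t *\<^sub>R b) - f x) / t) \<longlongrightarrow> gradient f x \<bullet> b) (at 0)"
    by (simp add: has_field_derivative_iff inner_commute)
  \<comment> \<open>The filter \<open>at 0\<close> excludes 0 itself; with \<open>Suc n\<close>
    every step size is nonzero.\<close>
  moreover have "filterlim (\<lambda>n. 1 / real (Suc n)) (at 0) sequentially"
    using LIMSEQ_Suc[OF lim_1_over_n[where 'a = real]] by (auto simp: filterlim_at)
  ultimately show ?thesis
    by (rule filterlim_compose)
qed

text \<open>The gradient of a differentiable function may be discontinuous, but its coordinates are
  pointwise limits of continuous difference quotients.\<close>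

lemma borel_measurable_gradient:
  fixes f :: "'v::euclidean_space \<Rightarrow> real"
  assumes f: "\<And>x. f differentiable (at x)"
  shows "gradient f \<in> borel_measurable borel"
proof -
  have "continuous_on UNIV f"
    using f by (auto intro: differentiable_imp_continuous_within continuous_at_imp_continuous_on)
  then have [measurable]: "f \<in> borel_measurable borel"
    by (rule borel_measurable_continuous_onI)
  show ?thesis
    by (subst borel_measurable_euclidean_space)
      (auto intro!: borel_measurable_LIMSEQ_real[OF gradient_difference_quotient[OF f]])
qed

lemma borel_measurable_sum_mset:
  fixes f :: "'x \<Rightarrow> 'a \<Rightarrow> 'b::{second_countable_topology, topological_comm_monoid_add}"
  assumes "\<And>x. x \<in># A \<Longrightarrow> f x \<in> borel_measurable M"
  shows "(\<lambda>w. \<Sum>x\<in>#A. f x w) \<in> borel_measurable M"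
  using assms
proof (induction A)
  case (add a A)
  then have "(\<lambda>w. f a w + (\<Sum>x\<in>#A. f x w)) \<in> borel_measurable M"
    by (intro borel_measurable_add) auto
  then show ?case by simp
qed simp

section \<open>Closed form and continuity of the preconditioner\<close>

text \<open>\<open>matrix_inv\<close> is a Hilbert choice. A right inverse of a square real matrix
  is two-sided, so there is only one candidate to choose.\<close>

lemma matrix_inv_eq:
  fixes A B :: "real^'n^'n"
  assumes "A ** B = mat 1"
  shows "matrix_inv A = B"
proof -
  have BA: "B ** A = mat 1"
    using assms matrix_left_right_inverse by blast
  then have "A ** matrix_inv A = mat 1 \<and> matrix_inv A ** A = mat 1"
    unfolding matrix_inv_def by (intro someI[where P = "\<lambda>A'. A ** A' = mat 1 \<and> A' ** A = mat 1" and x = B] conjI assms)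
  then show ?thesis
    using BA by (metis matrix_mul_assoc matrix_mul_lid matrix_mul_rid)
qed

text \<open>The Sherman--Morrison formula.\<close>

lemma preconditioner_eq:
  fixes M :: "real^'d::finite"
  assumes "\<rho> > 0"
  shows "preconditioner \<rho> M = (\<chi> i j. (of_bool (i = j) - M $ i * M $ j / (\<rho> + M \<bullet> M)) / \<rho>)"
  unfolding preconditioner_def
proof (rule matrix_inv_eq, unfold vec_eq_iff, intro allI)
  fix i j :: 'd
  define s where "s = \<rho> + M \<bullet> M"
  have s: "s > 0" using assms by (simp add: s_def add_pos_nonneg)
  have "((mat \<rho> + (\<chi> i j. M $ i * M $ j)) **
         (\<chi> i j. (of_bool (i = j) - M $ i * M $ j / s) / \<rho>)) $ i $ j =
    (\<Sum>k\<in>UNIV. (of_bool (i = k) * \<rho> + M $ i * M $ k) * ((of_bool (k = j) - M $ k * M $ j / s) / \<rho>))"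
    by (auto simp: matrix_matrix_mult_def mat_def intro!: sum.cong)
  \<comment> \<open>Regrouped so that the first two summands each collapse to a single index and the
    last one sums to a multiple of \<open>M \<bullet> M\<close>.\<close>
  also have "\<dots> = (\<Sum>k\<in>UNIV. of_bool (i = k) * (of_bool (k = j) - M $ k * M $ j / s)
      + of_bool (k = j) * (M $ i * M $ k / \<rho>) - M $ i * M $ j / (s * \<rho>) * (M $ k * M $ k))"
    using assms s by (intro sum.cong) (auto simp: field_simps)
  also have "\<dots> = of_bool (i = j) - M $ i * M $ j / s + M $ i * M $ j / \<rho> - M $ i * M $ j / (s * \<rho>) * (M \<bullet> M)"
    by (simp add: sum.distrib sum_subtractf sum_distrib_left inner_vec_def of_bool_def
        if_distrib[of "\<lambda>x. x * _"] if_distrib[of "\<lambda>x. x / _"] cong: if_cong)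
  also have "M \<bullet> M = s - \<rho>" by (simp add: s_def)
  also have "of_bool (i = j) - M $ i * M $ j / s + M $ i * M $ j / \<rho> - M $ i * M $ j / (s * \<rho>) * (s - \<rho>)
      = of_bool (i = j)"
    using assms s by (simp add: field_simps)
  finally show "((mat \<rho> + (\<chi> i j. M $ i * M $ j)) **
      (\<chi> i j. (of_bool (i = j) - M $ i * M $ j / (\<rho> + M \<bullet> M)) / \<rho>)) $ i $ j = mat 1 $ i $ j"
    by (simp add: s_def mat_def)
qed

text \<open>The closed form is rational in the entries of \<open>M\<close>, with the positive
  denominator \<open>\<rho> + M \<bullet> M\<close>.\<close>

lemma continuous_on_preconditioner:
  assumes "\<rho> > 0"
  shows "continuous_on UNIV (preconditioner \<rho> :: real^'d::finite \<Rightarrow> _)"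
proof -
  have "\<rho> + M \<bullet> M \<noteq> 0" for M :: "real^'d"
    using assms by (smt (verit) inner_ge_zero)
  then show ?thesis
    using assms unfolding preconditioner_eq[OF assms, abs_def] by (auto intro!: continuous_intros)
qed

section \<open>The noise laws as probability measures\<close>

lemma sets_isotropic_gaussian [measurable_cong]: "sets (isotropic_gaussian s) = sets borel"
  by (simp add: isotropic_gaussian_def)

text \<open>The pushforward has mass one because passing from coordinate functions to vectors is
  measurable, which is checked against the basis vectors.\<close>

lemma prob_space_isotropic_gaussian:
  assumes "s > 0"
  shows "prob_space (isotropic_gaussian s :: (real^'d::finite) measure)"
  unfolding isotropic_gaussian_def
proof (rule prob_space.prob_space_distr)
  show "prob_space (\<Pi>\<^sub>M j\<in>(UNIV :: 'd set). density lborel (normal_density 0 s))"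
    using assms by (intro prob_space_PiM prob_space_normal_density)
  have "(\<lambda>f. (\<chi> j. f j) \<bullet> i) \<in> borel_measurable (\<Pi>\<^sub>M j\<in>(UNIV :: 'd set). density lborel (normal_density 0 s))"
    if "i \<in> Basis" for i :: "real^'d"
  proof -
    obtain j where "i = axis j 1"
      using \<open>i \<in> Basis\<close> by (auto simp: Basis_vec_def)
    then have "(\<lambda>f. (\<chi> j. f j) \<bullet> i) = (\<lambda>f. f j)"
      by (simp add: inner_axis)
    moreover have "(\<lambda>f. f j) \<in> borel_measurable (\<Pi>\<^sub>M j\<in>(UNIV :: 'd set). density lborel (normal_density 0 s))"
      using measurable_component_singleton[of j UNIV "\<lambda>_. density lborel (normal_density 0 s)"] by simp
    ultimately show ?thesis
      by simp
  qed
  then show "(\<lambda>f. \<chi> j. f j) \<in> (\<Pi>\<^sub>M j\<in>(UNIV :: 'd set). density lborel (normal_density 0 s)) \<rightarrow>\<^sub>M borel"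
    by (subst borel_measurable_euclidean_space) blast
qed

lemma sets_round_noise [measurable_cong]: "sets (round_noise Cg \<sigma>g) = sets release_space"
  unfolding round_noise_def release_space_def by (intro sets_PiM_cong sets_isotropic_gaussian) simp

lemma measurable_round_noise:
  "round_noise Cg \<sigma>g \<rightarrow>\<^sub>M N = release_space \<rightarrow>\<^sub>M N" "N \<rightarrow>\<^sub>M round_noise Cg \<sigma>g = N \<rightarrow>\<^sub>M release_space"
  by (rule measurable_cong_sets; simp add: sets_round_noise)+

lemma prob_space_round_noise:
  assumes "Cg > 0" "\<sigma>g > 0"
  shows "prob_space (round_noise Cg \<sigma>g :: ('c::finite \<Rightarrow> real^'d::finite) measure)"
  unfolding round_noise_def using assms by (intro prob_space_PiM prob_space_isotropic_gaussian) simp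

section \<open>Client releases and server step as measurable maps\<close>

text \<open>Measurability is joint in state and noise, since after the first round the state is
  itself random.\<close>

lemma measurable_client_release:
  fixes loss :: "real^'d::finite \<Rightarrow> 'x \<Rightarrow> 'y \<Rightarrow> real"
    and D :: "('c::finite, 'x, 'y) federated"
  assumes "\<And>x y \<theta>. (\<lambda>\<theta>'. loss \<theta>' x y) differentiable (at \<theta>)"
  shows "(\<lambda>(st, E). client_release loss Cg D st E) \<in> borel \<Otimes>\<^sub>M release_space \<rightarrow>\<^sub>M release_space"
  unfolding release_space_def case_prod_beta
proof (rule measurable_PiM_single')
  fix i :: 'c
  have [measurable]: "gradient (\<lambda>\<theta>. loss \<theta> x y) \<in> borel_measurable borel" for x y
    using assms by (rule borel_measurable_gradient)
  \<comment> \<open>States carry the Borel sets of the product type, not a product sigma-algebra, so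
    the projections are measurable by continuity.\<close>
  have [measurable]: "(fst :: 'd server_state \<Rightarrow> _) \<in> borel_measurable borel"
    by (intro borel_measurable_continuous_onI continuous_intros)
  have [measurable]: "(\<lambda>w. \<Sum>z\<in>#D i. clip Cg (gradient (\<lambda>\<theta>. loss \<theta> (fst z) (snd z)) (fst (fst w))))
      \<in> borel_measurable ((borel :: 'd server_state measure) \<Otimes>\<^sub>M (\<Pi>\<^sub>M i\<in>(UNIV :: 'c set). (borel :: (real^'d) measure)))"
    unfolding clip_def by (intro borel_measurable_sum_mset) measurable
  show "(\<lambda>w. client_release loss Cg D (fst w) (snd w) i)
      \<in> borel_measurable ((borel :: 'd server_state measure) \<Otimes>\<^sub>M (\<Pi>\<^sub>M i\<in>(UNIV :: 'c set). borel))"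
    unfolding client_release_def case_prod_beta by measurable
qed (simp add: PiE_def)

lemma measurable_server_update:
  assumes "\<rho> > 0"
  shows "(\<lambda>(st, g :: 'c::finite \<Rightarrow> real^'d::finite). server_update \<beta> \<rho> h st g)
    \<in> borel \<Otimes>\<^sub>M release_space \<rightarrow>\<^sub>M borel"
proof -
  have [measurable]: "(aggregate :: ('c \<Rightarrow> real^'d) \<Rightarrow> _) \<in> release_space \<rightarrow>\<^sub>M borel"
    unfolding aggregate_def[abs_def] release_space_def by measurable
  have [measurable]: "(preconditioner \<rho> :: real^'d \<Rightarrow> _) \<in> borel \<rightarrow>\<^sub>M borel"
    using assms by (intro borel_measurable_continuous_onI continuous_on_preconditioner)
  have [measurable]: "(fst :: 'd server_state \<Rightarrow> _) \<in> borel_measurable borel"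
    "(snd :: 'd server_state \<Rightarrow> _) \<in> borel_measurable borel"
    by (intro borel_measurable_continuous_onI continuous_intros)+
  have "continuous_on UNIV (\<lambda>w :: (real^'d^'d) \<times> (real^'d). fst w *v snd w)"
    unfolding matrix_vector_mult_def by (intro continuous_intros)
  then have [measurable]: "(\<lambda>w :: (real^'d^'d) \<times> (real^'d). fst w *v snd w) \<in> borel \<rightarrow>\<^sub>M borel"
    by (rule borel_measurable_continuous_onI)
  have mv[measurable (raw)]: "(\<lambda>x. A x *v v x) \<in> borel_measurable M"
    if [measurable]: "A \<in> borel_measurable M" "v \<in> borel_measurable M"
    for A :: "_ \<Rightarrow> real^'d^'d" and v and M :: "('d server_state \<times> ('c \<Rightarrow> real^'d)) measure"
    using measurable_compose[of "\<lambda>x. (A x, v x)" M borel "\<lambda>w. fst w *v snd w" borel] by simp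
  show ?thesis
    unfolding server_update_def case_prod_beta Let_def by measurable
qed

section \<open>The full algorithm as an adaptive composition\<close>

text \<open>Here \<open>st\<close> is the state after the round: its first component is the new
  parameter vector and its second the momentum of that same round.\<close>

definition server_output :: "real \<Rightarrow> 'd server_state \<Rightarrow> (real^'d) \<times> (real^'d^'d) \<times> (real^'d::finite)" where
  "server_output \<rho> st = (snd st, preconditioner \<rho> (snd st), fst st)"

lemma measurable_server_output:
  assumes "\<rho> > 0"
  shows "server_output \<rho> \<in> borel_measurable (borel :: 'd::finite server_state measure)"
  unfolding server_output_def[abs_def]
  using assms
  by (intro borel_measurable_continuous_onI continuous_intros
      continuous_on_compose2[OF continuous_on_preconditioner]) auto

text \<open>
  The outputs of the rounds before \<open>t\<close> determine the server state before round \<open>t\<close>, which is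
  what makes the algorithm an adaptive composition of the release mechanisms.
\<close>

definition last_state ::
    "real^'d \<Rightarrow> nat \<Rightarrow> (nat \<Rightarrow> (real^'d) \<times> (real^'d^'d) \<times> (real^'d::finite)) \<Rightarrow> 'd server_state" where
  "last_state \<theta>0 t w = (case t of 0 \<Rightarrow> (\<theta>0, 0) | Suc s \<Rightarrow> (snd (snd (w s)), fst (w s)))"

lemma measurable_last_state:
  "last_state (\<theta>0 :: real^'d::finite) t \<in> output_space t \<rightarrow>\<^sub>M borel"
proof (cases t)
  case (Suc s)
  have [measurable]: "(\<lambda>w. w s) \<in> output_space t \<rightarrow>\<^sub>M (borel :: ((real^'d) \<times> (real^'d^'d) \<times> (real^'d)) measure)"
    unfolding output_space_def Suc by (rule measurable_component_singleton) simp
  have [measurable]: "(\<lambda>z :: (real^'d) \<times> (real^'d^'d) \<times> (real^'d). (snd (snd z), fst z)) \<in> borel \<rightarrow>\<^sub>M borel"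
    by (intro borel_measurable_continuous_onI continuous_intros)
  have "(\<lambda>w. (snd (snd (w s)), fst (w s))) \<in> output_space t \<rightarrow>\<^sub>M (borel :: 'd server_state measure)"
    using measurable_compose[of "\<lambda>w. w s" "output_space t" borel "\<lambda>z. (snd (snd z), fst z)" borel] by simp
  then show ?thesis
    by (simp add: last_state_def[abs_def] Suc)
qed (simp add: last_state_def[abs_def])

text \<open>Causality: drawing the noise of a further round leaves all earlier states, hence all
  earlier outputs, unchanged.\<close>

lemma fedsofim_state_cong:
  assumes "\<And>s. s < t \<Longrightarrow> E s = E' s"
  shows "fedsofim_state loss \<theta>0 \<beta> \<rho> \<eta> Cg D E t = fedsofim_state loss \<theta>0 \<beta> \<rho> \<eta> Cg D E' t"
  using assms by (induction t) (auto simp: Let_def)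

text \<open>The last output triple contains both components of the state. For \<open>T = 0\<close>
  nothing has been output, and both sides are the fixed initial state.\<close>

lemma last_state_output:
  "last_state \<theta>0 T (fedsofim_output loss \<theta>0 \<beta> \<rho> \<eta> Cg T D E) = fedsofim_state loss \<theta>0 \<beta> \<rho> \<eta> Cg D E T"
  by (cases T) (auto simp: last_state_def fedsofim_output_def case_prod_beta Let_def)

text \<open>Depends on data and noise only through the releases \<open>g\<close>; for fixed past
  outputs \<open>w\<close> it is therefore a post-processing map.\<close>

definition extend_output ::
    "real^'d \<Rightarrow> real \<Rightarrow> real \<Rightarrow> (nat \<Rightarrow> real) \<Rightarrow> nat \<Rightarrow>
     (nat \<Rightarrow> (real^'d) \<times> (real^'d^'d) \<times> (real^'d::finite)) \<Rightarrow> ('c::finite \<Rightarrow> real^'d) \<Rightarrow>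
     nat \<Rightarrow> (real^'d) \<times> (real^'d^'d) \<times> (real^'d)" where
  "extend_output \<theta>0 \<beta> \<rho> \<eta> T w g =
     w(T := server_output \<rho> (server_update \<beta> \<rho> (\<eta> T) (last_state \<theta>0 T w) g))"

lemma fedsofim_output_Suc:
  "fedsofim_output loss \<theta>0 \<beta> \<rho> \<eta> Cg (Suc T) D (E(T := e)) =
   (let w = fedsofim_output loss \<theta>0 \<beta> \<rho> \<eta> Cg T D E
    in extend_output \<theta>0 \<beta> \<rho> \<eta> T w (client_release loss Cg D (last_state \<theta>0 T w) e))"
proof -
  have "fedsofim_state loss \<theta>0 \<beta> \<rho> \<eta> Cg D (E(T := e)) t = fedsofim_state loss \<theta>0 \<beta> \<rho> \<eta> Cg D E t"
    if "t \<le> T" for t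
    using that by (intro fedsofim_state_cong) auto
  note state = this this[unfolded fedsofim_state.simps(2)]
  \<comment> \<open>For \<open>t < T\<close> the output uses the state before round
    \<open>Suc t \<le> T\<close>, which the noise of round \<open>T\<close> does not reach; for
    \<open>t > T\<close> both sides are \<open>undefined\<close>.\<close>
  have early: "fedsofim_output loss \<theta>0 \<beta> \<rho> \<eta> Cg (Suc T) D (E(T := e)) t =
      fedsofim_output loss \<theta>0 \<beta> \<rho> \<eta> Cg T D E t" if "t \<noteq> T" for t
    using that state(1)[of "Suc t"] by (auto simp: fedsofim_output_def simp del: fedsofim_state.simps)
  show ?thesis
    unfolding Let_def extend_output_def last_state_output
  proof (rule ext)
    fix t
    show "fedsofim_output loss \<theta>0 \<beta> \<rho> \<eta> Cg (Suc T) D (E(T := e)) t =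
      ((fedsofim_output loss \<theta>0 \<beta> \<rho> \<eta> Cg T D E)(T := server_output \<rho> (server_update \<beta> \<rho> (\<eta> T)
        (fedsofim_state loss \<theta>0 \<beta> \<rho> \<eta> Cg D E T)
        (client_release loss Cg D (fedsofim_state loss \<theta>0 \<beta> \<rho> \<eta> Cg D E T) e)))) t"
      using early[of t] state(1)[of T]
      by (cases "t = T") (auto simp: fedsofim_output_def server_output_def case_prod_beta Let_def)
  qed
qed

lemma measurable_extend_output:
  assumes "\<rho> > 0"
  shows "(\<lambda>(w, g :: 'c::finite \<Rightarrow> real^'d::finite). extend_output \<theta>0 \<beta> \<rho> \<eta> T w g)
    \<in> output_space T \<Otimes>\<^sub>M release_space \<rightarrow>\<^sub>M output_space (Suc T)"
proof -
  note [measurable] = measurable_last_state measurable_server_output[OF assms]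
    measurable_server_update[OF assms]
  have "(\<lambda>(w, g :: 'c \<Rightarrow> real^'d). (w, server_output \<rho> (server_update \<beta> \<rho> (\<eta> T) (last_state \<theta>0 T w) g)))
      \<in> output_space T \<Otimes>\<^sub>M release_space \<rightarrow>\<^sub>M output_space T \<Otimes>\<^sub>M borel"
    by measurable
  from measurable_compose[OF this, of "\<lambda>(f, y). f(T := y)" "output_space (Suc T)"]
  show ?thesis
    using measurable_add_dim[of T "{..<T}" "\<lambda>_. borel"]
    by (simp add: output_space_def lessThan_Suc extend_output_def case_prod_beta)
qed

section \<open>One round as a Markov kernel\<close>

text \<open>The result keeps the past outputs \<open>w\<close>, so that rounds can be chained by
  bind. Writing it as a pushforward of the release mechanism makes the privacy hypothesis applicable
  by post-processing.\<close>

definition round_kernel ::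
    "(real^'d \<Rightarrow> 'x \<Rightarrow> 'y \<Rightarrow> real) \<Rightarrow> real^'d \<Rightarrow> real \<Rightarrow> real \<Rightarrow> (nat \<Rightarrow> real) \<Rightarrow> real \<Rightarrow> real \<Rightarrow> nat \<Rightarrow>
     ('c::finite, 'x, 'y) federated \<Rightarrow> (nat \<Rightarrow> (real^'d) \<times> (real^'d^'d) \<times> (real^'d::finite)) \<Rightarrow>
     (nat \<Rightarrow> (real^'d) \<times> (real^'d^'d) \<times> (real^'d)) measure" where
  "round_kernel loss \<theta>0 \<beta> \<rho> \<eta> Cg \<sigma>g T D w =
     distr (release_mechanism loss Cg \<sigma>g (last_state \<theta>0 T w) D) (output_space (Suc T))
       (extend_output \<theta>0 \<beta> \<rho> \<eta> T w)"

context
  fixes loss :: "real^'d::finite \<Rightarrow> 'x \<Rightarrow> 'y \<Rightarrow> real"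
    and \<theta>0 :: "real^'d"
    and \<beta> \<rho> Cg \<sigma>g :: real
    and \<eta> :: "nat \<Rightarrow> real"
  assumes \<rho>: "\<rho> > 0" and Cg: "Cg > 0" and \<sigma>g: "\<sigma>g > 0"
    and diff: "\<And>x y \<theta>. (\<lambda>\<theta>'. loss \<theta>' x y) differentiable (at \<theta>)"
begin

lemma measurable_client_release_state:
  fixes D :: "('c::finite, 'x, 'y) federated"
  shows "client_release loss Cg D st \<in> release_space \<rightarrow>\<^sub>M release_space"
proof -
  have "(\<lambda>E. (st, E)) \<in> release_space \<rightarrow>\<^sub>M borel \<Otimes>\<^sub>M (release_space :: ('c \<Rightarrow> real^'d) measure)"
    by (rule measurable_Pair1') simp
  from measurable_compose[OF this measurable_client_release[where loss = loss and D = D, OF diff]]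
  show ?thesis by simp
qed

lemma measurable_client_release_noise:
  fixes D :: "('c::finite, 'x, 'y) federated"
  shows "client_release loss Cg D st \<in> round_noise Cg \<sigma>g \<rightarrow>\<^sub>M release_space"
  unfolding measurable_round_noise by (rule measurable_client_release_state)

lemma measurable_extend_output_fixed:
  fixes w :: "nat \<Rightarrow> (real^'d) \<times> (real^'d^'d) \<times> (real^'d)"
  assumes "w \<in> space (output_space T)"
  shows "(extend_output \<theta>0 \<beta> \<rho> \<eta> T w :: ('c::finite \<Rightarrow> real^'d) \<Rightarrow> _) \<in> release_space \<rightarrow>\<^sub>M output_space (Suc T)"
  using measurable_compose[OF measurable_Pair1'[OF assms] measurable_extend_output[OF \<rho>]]
  by simp

text \<open>The law being pushed forward no longer depends on \<open>w\<close>; measurability in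
  \<open>w\<close> then follows from that of the joint map of \<open>w\<close> and
  \<open>e\<close>.\<close>

lemma round_kernel_eq:
  fixes D :: "('c::finite, 'x, 'y) federated"
  assumes "w \<in> space (output_space T)"
  shows "round_kernel loss \<theta>0 \<beta> \<rho> \<eta> Cg \<sigma>g T D w =
    distr (round_noise Cg \<sigma>g) (output_space (Suc T))
      (\<lambda>e. extend_output \<theta>0 \<beta> \<rho> \<eta> T w (client_release loss Cg D (last_state \<theta>0 T w) e))"
  unfolding round_kernel_def release_mechanism_def
  unfolding distr_distr[OF measurable_extend_output_fixed[OF assms] measurable_client_release_noise]
  by (simp only: comp_def)

lemma measurable_round:
  fixes D :: "('c::finite, 'x, 'y) federated"
  shows "(\<lambda>(w, e). extend_output \<theta>0 \<beta> \<rho> \<eta> T w (client_release loss Cg D (last_state \<theta>0 T w) e))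
    \<in> output_space T \<Otimes>\<^sub>M release_space \<rightarrow>\<^sub>M output_space (Suc T)"
proof -
  note [measurable] = measurable_last_state measurable_client_release[where loss = loss, OF diff] measurable_extend_output[OF \<rho>]
  show ?thesis by measurable
qed

lemma measurable_round_kernel:
  "round_kernel loss \<theta>0 \<beta> \<rho> \<eta> Cg \<sigma>g T (D :: ('c::finite, 'x, 'y) federated)
    \<in> output_space T \<rightarrow>\<^sub>M prob_algebra (output_space (Suc T))"
proof (subst measurable_cong[OF round_kernel_eq])
  have "(round_noise Cg \<sigma>g :: ('c \<Rightarrow> real^'d) measure) \<in> space (prob_algebra release_space)"
    using prob_space_round_noise[OF Cg \<sigma>g] by (simp add: space_prob_algebra sets_round_noise)
  then show "(\<lambda>w. distr (round_noise Cg \<sigma>g) (output_space (Suc T))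
      (\<lambda>e. extend_output \<theta>0 \<beta> \<rho> \<eta> T w (client_release loss Cg D (last_state \<theta>0 T w) e)))
    \<in> output_space T \<rightarrow>\<^sub>M prob_algebra (output_space (Suc T))"
    by (intro measurable_distr_prob_space2[OF _ measurable_round] measurable_const)
qed

section \<open>The law of the full algorithm as an iterated bind\<close>

lemma measurable_fedsofim_output:
  fixes D :: "('c::finite, 'x, 'y) federated"
  shows "fedsofim_output loss \<theta>0 \<beta> \<rho> \<eta> Cg T D
    \<in> (\<Pi>\<^sub>M t\<in>{..<T}. round_noise Cg \<sigma>g) \<rightarrow>\<^sub>M output_space T"
proof -
  \<comment> \<open>The range includes \<open>t = T\<close>, because output component
    \<open>t\<close> is read from the state before round \<open>Suc t\<close>.\<close>
  have state: "(\<lambda>E. fedsofim_state loss \<theta>0 \<beta> \<rho> \<eta> Cg D E t)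
      \<in> (\<Pi>\<^sub>M t\<in>{..<T}. round_noise Cg \<sigma>g) \<rightarrow>\<^sub>M borel" if "t \<le> T" for t
    using that
  proof (induction t)
    case (Suc t)
    then have st: "(\<lambda>E. fedsofim_state loss \<theta>0 \<beta> \<rho> \<eta> Cg D E t)
        \<in> (\<Pi>\<^sub>M t\<in>{..<T}. round_noise Cg \<sigma>g) \<rightarrow>\<^sub>M borel"
      by simp
    have "(\<lambda>E. E t)
        \<in> (\<Pi>\<^sub>M t\<in>{..<T}. round_noise Cg \<sigma>g) \<rightarrow>\<^sub>M (round_noise Cg \<sigma>g :: ('c \<Rightarrow> real^'d) measure)"
      using Suc.prems by (intro measurable_component_singleton) simp
    then have E: "(\<lambda>E. E t) \<in> (\<Pi>\<^sub>M t\<in>{..<T}. round_noise Cg \<sigma>g) \<rightarrow>\<^sub>M (release_space :: ('c \<Rightarrow> real^'d) measure)"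
      by (simp only: measurable_round_noise)
    have release: "(\<lambda>E. client_release loss Cg D (fedsofim_state loss \<theta>0 \<beta> \<rho> \<eta> Cg D E t) (E t))
        \<in> (\<Pi>\<^sub>M t\<in>{..<T}. round_noise Cg \<sigma>g) \<rightarrow>\<^sub>M release_space"
      using measurable_compose[OF measurable_Pair[OF st E]
          measurable_client_release[where loss = loss and D = D, OF diff]] by simp
    show ?case
      using measurable_compose[OF measurable_Pair[OF st release] measurable_server_update[OF \<rho>]]
      by (simp add: Let_def)
  qed simp
  have "(\<lambda>E. \<lambda>t\<in>{..<T}. server_output \<rho> (fedsofim_state loss \<theta>0 \<beta> \<rho> \<eta> Cg D E (Suc t)))
      \<in> (\<Pi>\<^sub>M t\<in>{..<T}. round_noise Cg \<sigma>g) \<rightarrow>\<^sub>M output_space T"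
    unfolding output_space_def
    by (intro measurable_restrict measurable_compose[OF state measurable_server_output[OF \<rho>]])
      (simp add: Suc_leI)
  then show ?thesis
    by (simp add: fedsofim_output_def[abs_def] server_output_def case_prod_beta Let_def
        del: fedsofim_state.simps)
qed

lemma prob_space_dp_fedsofim:
  "prob_space (dp_fedsofim loss \<theta>0 \<beta> \<rho> \<eta> Cg \<sigma>g T (D :: ('c::finite, 'x, 'y) federated))"
  unfolding dp_fedsofim_def
  by (intro prob_space.prob_space_distr prob_space_PiM prob_space_round_noise Cg \<sigma>g
      measurable_fedsofim_output)

lemma sets_dp_fedsofim:
  "sets (dp_fedsofim loss \<theta>0 \<beta> \<rho> \<eta> Cg \<sigma>g T (D :: ('c::finite, 'x, 'y) federated)) = sets (output_space T)"
  by (simp add: dp_fedsofim_def)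

text \<open>The noise of round \<open>T\<close> is independent of the earlier noise, so by Fubini it
  can be integrated first, with the past outputs held fixed.\<close>

lemma dp_fedsofim_Suc:
  fixes D :: "('c::finite, 'x, 'y) federated"
  shows "dp_fedsofim loss \<theta>0 \<beta> \<rho> \<eta> Cg \<sigma>g (Suc T) D =
    dp_fedsofim loss \<theta>0 \<beta> \<rho> \<eta> Cg \<sigma>g T D \<bind> round_kernel loss \<theta>0 \<beta> \<rho> \<eta> Cg \<sigma>g T D"
  (is "?L = Giry_Monad.bind ?M ?K")
proof (rule measure_eqI)
  interpret M: prob_space ?M by (rule prob_space_dp_fedsofim)
  let ?noise = "round_noise Cg \<sigma>g :: ('c \<Rightarrow> real^'d) measure"
  interpret noise: prob_space ?noise by (rule prob_space_round_noise[OF Cg \<sigma>g])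
  interpret product_sigma_finite "\<lambda>_ :: nat. ?noise"
    by (simp add: product_sigma_finite_def noise.sigma_finite_measure_axioms)
  let ?out = "\<lambda>t. fedsofim_output loss \<theta>0 \<beta> \<rho> \<eta> Cg t D"
  have K: "?K \<in> ?M \<rightarrow>\<^sub>M prob_algebra (output_space (Suc T))"
    using measurable_round_kernel measurable_cong_sets[OF sets_dp_fedsofim refl] by blast
  have "sets (?K w) = sets (output_space (Suc T))" for w
    by (simp add: round_kernel_def)
  then show "sets ?L = sets (Giry_Monad.bind ?M ?K)"
    using M.not_empty by (simp add: sets_dp_fedsofim)
  fix A assume "A \<in> sets ?L"
  then have A[measurable]: "A \<in> sets (output_space (Suc T))"
    by (simp add: sets_dp_fedsofim)
  have K_emeasure: "emeasure (?K w) A = (\<integral>\<^sup>+e. indicator A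
      (extend_output \<theta>0 \<beta> \<rho> \<eta> T w (client_release loss Cg D (last_state \<theta>0 T w) e)) \<partial>?noise)"
    if w: "w \<in> space (output_space T)" for w
  proof -
    have "(\<lambda>e. extend_output \<theta>0 \<beta> \<rho> \<eta> T w (client_release loss Cg D (last_state \<theta>0 T w) e))
        \<in> ?noise \<rightarrow>\<^sub>M output_space (Suc T)"
      using measurable_compose[OF measurable_Pair1'[OF w] measurable_round]
      by (simp add: measurable_round_noise)
    then show ?thesis
      unfolding round_kernel_eq[OF w] by (rule emeasure_distr_integral[OF _ A])
  qed
  have "emeasure ?L A = (\<integral>\<^sup>+E. indicator A (?out (Suc T) E) \<partial>(\<Pi>\<^sub>M t\<in>{..<Suc T}. ?noise))"
    unfolding dp_fedsofim_def by (rule emeasure_distr_integral[OF measurable_fedsofim_output A])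
  also have "\<dots> = (\<integral>\<^sup>+E. (\<integral>\<^sup>+e. indicator A (?out (Suc T) (E(T := e))) \<partial>?noise) \<partial>(\<Pi>\<^sub>M t\<in>{..<T}. ?noise))"
    unfolding lessThan_Suc
  proof (rule product_nn_integral_insert)
    have "(\<lambda>E. indicator A (?out (Suc T) E) :: ennreal) \<in> borel_measurable (\<Pi>\<^sub>M t\<in>{..<Suc T}. ?noise)"
      by (rule measurable_compose[OF measurable_fedsofim_output borel_measurable_indicator[OF A]])
    then show "(\<lambda>E. indicator A (?out (Suc T) E) :: ennreal) \<in> borel_measurable (Pi\<^sub>M (insert T {..<T}) (\<lambda>_. ?noise))"
      by (simp only: lessThan_Suc)
  qed simp_all
  \<comment> \<open>By the recursion for outputs, the inner integrand sees the earlier noise only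
    through the outputs of the first \<open>T\<close> rounds.\<close>
  also have "\<dots> = (\<integral>\<^sup>+E. emeasure (?K (?out T E)) A \<partial>(\<Pi>\<^sub>M t\<in>{..<T}. ?noise))"
    using K_emeasure[OF measurable_space[OF measurable_fedsofim_output[of T D]]]
    by (intro nn_integral_cong) (simp add: fedsofim_output_Suc Let_def)
  also have "\<dots> = (\<integral>\<^sup>+w. emeasure (?K w) A \<partial>?M)"
    unfolding dp_fedsofim_def
    using measurable_emeasure_kernel[OF measurable_prob_algebraD[OF measurable_round_kernel] A]
    by (intro nn_integral_distr[symmetric] measurable_fedsofim_output) simp
  also have "\<dots> = emeasure (Giry_Monad.bind ?M ?K) A"
    by (rule emeasure_bind[OF M.not_empty measurable_prob_algebraD[OF K] A, symmetric])
  finally show "emeasure ?L A = emeasure (Giry_Monad.bind ?M ?K) A" .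
qed

section \<open>Composition over all rounds\<close>

lemma indistinguishable_dp_fedsofim:
  fixes D D' :: "('c::finite, 'x, 'y) federated"
  assumes "\<And>t st. t < T \<Longrightarrow>
    indistinguishable (\<epsilon> t) (\<delta> t) (release_mechanism loss Cg \<sigma>g st D) (release_mechanism loss Cg \<sigma>g st D')"
  shows "indistinguishable (\<Sum>t<T. \<epsilon> t) (\<Sum>t<T. \<delta> t)
    (dp_fedsofim loss \<theta>0 \<beta> \<rho> \<eta> Cg \<sigma>g T D) (dp_fedsofim loss \<theta>0 \<beta> \<rho> \<eta> Cg \<sigma>g T D')"
  using assms
proof (induction T)
  case 0
  \<comment> \<open>With no rounds, both outputs are \<open>undefined\<close> everywhere, so the two
    laws coincide.\<close>
  have "fedsofim_output loss \<theta>0 \<beta> \<rho> \<eta> Cg 0 D = fedsofim_output loss \<theta>0 \<beta> \<rho> \<eta> Cg 0 D'"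
    by (simp add: fedsofim_output_def fun_eq_iff)
  then show ?case
    by (simp add: dp_fedsofim_def indistinguishable_refl)
next
  case (Suc T)
  have K: "round_kernel loss \<theta>0 \<beta> \<rho> \<eta> Cg \<sigma>g T X
      \<in> dp_fedsofim loss \<theta>0 \<beta> \<rho> \<eta> Cg \<sigma>g T D \<rightarrow>\<^sub>M prob_algebra (output_space (Suc T))"
    for X :: "('c, 'x, 'y) federated"
    using measurable_round_kernel measurable_cong_sets[OF sets_dp_fedsofim refl] by blast
  have "indistinguishable (\<epsilon> T) (\<delta> T)
      (round_kernel loss \<theta>0 \<beta> \<rho> \<eta> Cg \<sigma>g T D w) (round_kernel loss \<theta>0 \<beta> \<rho> \<eta> Cg \<sigma>g T D' w)"
    if "w \<in> space (dp_fedsofim loss \<theta>0 \<beta> \<rho> \<eta> Cg \<sigma>g T D)" for w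
  proof -
    have "w \<in> space (output_space T)"
      using that sets_eq_imp_space_eq[OF sets_dp_fedsofim] by blast
    then show ?thesis
      \<comment> \<open>The past outputs \<open>w\<close> fix the server state, so the hypothesis at
        that state applies, followed by the data-independent \<open>extend_output\<close>.\<close>
      unfolding round_kernel_def
      by (intro indistinguishable_distr Suc.prems)
        (simp_all add: release_mechanism_def measurable_extend_output_fixed)
  qed
  then show ?case
    unfolding dp_fedsofim_Suc sum.lessThan_Suc
    using Suc by (intro indistinguishable_bind[OF _ _ _ K K] prob_space_dp_fedsofim)
      (simp_all add: sets_dp_fedsofim)
qed

text \<open>The inequality comes from the composition for each neighboring pair; that the outputs
  have probability laws on \<open>output_space T\<close> comes from measurability.\<close>

lemma differentially_private_dp_fedsofim:
  assumes "\<And>t \<theta> M. t < T \<Longrightarrow> differentially_private neighboring release_space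
    (release_mechanism loss Cg \<sigma>g (\<theta>, M) :: ('c::finite, 'x, 'y) federated \<Rightarrow> _) (\<epsilon> t) (\<delta> t)"
  shows "differentially_private neighboring (output_space T)
    (dp_fedsofim loss \<theta>0 \<beta> \<rho> \<eta> Cg \<sigma>g T :: ('c, 'x, 'y) federated \<Rightarrow> _) (\<Sum>t<T. \<epsilon> t) (\<Sum>t<T. \<delta> t)"
proof -
  have "indistinguishable (\<Sum>t<T. \<epsilon> t) (\<Sum>t<T. \<delta> t)
      (dp_fedsofim loss \<theta>0 \<beta> \<rho> \<eta> Cg \<sigma>g T D) (dp_fedsofim loss \<theta>0 \<beta> \<rho> \<eta> Cg \<sigma>g T D')"
    if "neighboring D D'" for D D' :: "('c, 'x, 'y) federated"
  proof (rule indistinguishable_dp_fedsofim)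
    fix t and st :: "'d server_state" assume "t < T"
    have sets: "sets (release_mechanism loss Cg \<sigma>g st D) = sets release_space"
      by (simp add: release_mechanism_def)
    show "indistinguishable (\<epsilon> t) (\<delta> t) (release_mechanism loss Cg \<sigma>g st D) (release_mechanism loss Cg \<sigma>g st D')"
      using assms[OF \<open>t < T\<close>, of "fst st" "snd st"] \<open>neighboring D D'\<close>
      unfolding differentially_private_def indistinguishable_def sets prod.collapse by blast
  qed
  then show ?thesis
    unfolding differentially_private_def randomized_mechanism_def indistinguishable_def sets_dp_fedsofim
    using prob_space_dp_fedsofim by blast
qed

end

theorem theorem4p37:
  fixes loss :: "real^'d::finite \<Rightarrow> 'x \<Rightarrow> 'y \<Rightarrow> real"
    and \<theta>0 :: "real^'d"
    and \<beta> \<rho> Cg \<sigma>g :: real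
    and \<eta> :: "nat \<Rightarrow> real"
    and T :: nat
  assumes "T \<ge> 1"
    and "0 \<le> \<beta>" "\<beta> < 1"
    and "\<rho> > 0"
    and "\<And>t. t < T \<Longrightarrow> \<eta> t > 0"
    and "Cg > 0" "\<sigma>g > 0"
    and "\<And>x y \<theta>. (\<lambda>\<theta>'. loss \<theta>' x y) differentiable (at \<theta>)"
  shows "(\<forall>\<epsilon> \<delta> :: nat \<Rightarrow> real.
            (\<forall>t<T. \<forall>\<theta> M. differentially_private neighboring release_space
               (release_mechanism loss Cg \<sigma>g (\<theta>, M) ::
                  ('c::finite, 'x, 'y) federated \<Rightarrow> ('c \<Rightarrow> real^'d) measure) (\<epsilon> t) (\<delta> t)) \<longrightarrow>
            differentially_private neighboring (output_space T)
              (dp_fedsofim loss \<theta>0 \<beta> \<rho> \<eta> Cg \<sigma>g T ::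
                 ('c, 'x, 'y) federated \<Rightarrow> _) (\<Sum>t<T. \<epsilon> t) (\<Sum>t<T. \<delta> t))
       \<and> (\<forall>\<epsilon>0 \<delta>0 :: real.
            (\<forall>t<T. \<forall>\<theta> M. differentially_private neighboring release_space
               (release_mechanism loss Cg \<sigma>g (\<theta>, M) ::
                  ('c, 'x, 'y) federated \<Rightarrow> ('c \<Rightarrow> real^'d) measure) \<epsilon>0 \<delta>0) \<longrightarrow>
            differentially_private neighboring (output_space T)
              (dp_fedsofim loss \<theta>0 \<beta> \<rho> \<eta> Cg \<sigma>g T ::
                 ('c, 'x, 'y) federated \<Rightarrow> _) (real T * \<epsilon>0) (real T * \<delta>0))"
proof (intro conjI allI impI)
  fix \<epsilon> \<delta> :: "nat \<Rightarrow> real"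
  assume "\<forall>t<T. \<forall>\<theta> M. differentially_private neighboring release_space
    (release_mechanism loss Cg \<sigma>g (\<theta>, M) :: ('c, 'x, 'y) federated \<Rightarrow> _) (\<epsilon> t) (\<delta> t)"
  then show "differentially_private neighboring (output_space T)
      (dp_fedsofim loss \<theta>0 \<beta> \<rho> \<eta> Cg \<sigma>g T :: ('c, 'x, 'y) federated \<Rightarrow> _) (\<Sum>t<T. \<epsilon> t) (\<Sum>t<T. \<delta> t)"
    using assms by (intro differentially_private_dp_fedsofim) blast+
next
  fix \<epsilon>0 \<delta>0 :: real
  assume "\<forall>t<T. \<forall>\<theta> M. differentially_private neighboring release_space
    (release_mechanism loss Cg \<sigma>g (\<theta>, M) :: ('c, 'x, 'y) federated \<Rightarrow> _) \<epsilon>0 \<delta>0"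
  \<comment> \<open>Constant parameter sequences; their sums over \<open>t < T\<close> are the
    claimed products.\<close>
  then have "differentially_private neighboring (output_space T)
      (dp_fedsofim loss \<theta>0 \<beta> \<rho> \<eta> Cg \<sigma>g T :: ('c, 'x, 'y) federated \<Rightarrow> _) (\<Sum>t<T. \<epsilon>0) (\<Sum>t<T. \<delta>0)"
    using assms by (intro differentially_private_dp_fedsofim) blast+
  then show "differentially_private neighboring (output_space T)
      (dp_fedsofim loss \<theta>0 \<beta> \<rho> \<eta> Cg \<sigma>g T :: ('c, 'x, 'y) federated \<Rightarrow> _) (real T * \<epsilon>0) (real T * \<delta>0)"
    by simp
qed

end
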